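(* Any real $d$-variate polynomial $p$ of weight $W$ that satisfies $|p(x)-\mathrm{OR}_d(x)|\le1/6$ for all $x\in\{-1,1\}^d$ has degree at least $d/2^{O(\sqrt{\log W})}$.
   Context: $\mathrm{OR}_d:\{-1,1\}^d\to\{-1,1\}$ is the OR function with $-1$ meaning TRUE and $1$ meaning FALSE. For $p(x)=\sum_{S\subseteq[d]}c_S\prod_{i\in S}x_i$, the degree is $\max\{|S|:c_S\ne0\}$ and the weight is $\sum_S|c_S|$. The $O(\cdot)$ hides a universal constant. *)

theory Defs
  imports Complex_Main "HOL-Library.FuncSet"
begin

text \<open>
  A real \<open>d\<close>-variate multilinear polynomial is represented by its coefficients \<open>c S\<close> for
  \<open>S \<subseteq> {1..d}\<close>; values of \<open>c\<close> at other sets are ignored.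
\<close>

definition cube :: "nat \<Rightarrow> (nat \<Rightarrow> real) set" where
  "cube d = {1..d} \<rightarrow>\<^sub>E {-1, 1}"

text \<open>The value \<open>-1\<close> encodes true and \<open>1\<close> encodes false.\<close>

definition OR :: "nat \<Rightarrow> (nat \<Rightarrow> real) \<Rightarrow> real" where
  "OR d x = (if \<exists>i\<in>{1..d}. x i = -1 then -1 else 1)"

definition ml_eval :: "nat \<Rightarrow> (nat set \<Rightarrow> real) \<Rightarrow> (nat \<Rightarrow> real) \<Rightarrow> real" where
  "ml_eval d c x = (\<Sum>S\<in>Pow {1..d}. c S * (\<Prod>i\<in>S. x i))"

text \<open>The degree is meaningful only for nonzero polynomials (\<open>Max {}\<close> is unspecified).\<close>

definition ml_degree :: "nat \<Rightarrow> (nat set \<Rightarrow> real) \<Rightarrow> nat" where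
  "ml_degree d c = Max {card S | S. S \<subseteq> {1..d} \<and> c S \<noteq> 0}"

definition ml_weight :: "nat \<Rightarrow> (nat set \<Rightarrow> real) \<Rightarrow> real" where
  "ml_weight d c = (\<Sum>S\<in>Pow {1..d}. \<bar>c S\<bar>)"

end

theory Submission
  imports Defs
begin

text \<open>
  Averaging \<open>p\<close> over independent coordinates of mean \<open>t\<close> gives the univariate polynomial
  \<open>q t = (\<Sum>S. c S * t ^ card S)\<close>, which is within \<open>1/6\<close> of \<open>-1 + 2 * ((1 + t) / 2) ^ d\<close> on \<open>[-1, 1]\<close>.
  Hence \<open>q 1 \<ge> 5/6\<close>, while \<open>q\<close> is within \<open>1/3\<close> of \<open>-1\<close> on \<open>[-1, 1 - 22/d]\<close>.
  Richardson extrapolation to \<open>t = 1\<close> from the nodes \<open>1 - 8 ^ i * 22/d\<close>, \<open>i \<le> k\<close>, uses coefficients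
  whose absolute values sum to at most \<open>2\<close>, and it is exact up to degree \<open>k\<close> in \<open>1 - t\<close>.
  Its error on \<open>q\<close> is therefore at least \<open>7/6\<close>, but also at most \<open>W * (22 * 8 ^ k * D / d) ^ k\<close>, where
  \<open>D\<close> is the degree. The choice \<open>k = \<lceil>sqrt (log 2 W)\<rceil>\<close> gives the bound.
\<close>

subsection \<open>Richardson extrapolation with geometric nodes\<close>

text \<open>Scaling \<open>s\<close> by \<open>b\<close> multiplies the level-\<open>k\<close> value
  on a monomial of degree \<open>m\<close> by \<open>b ^ m\<close>, so for \<open>m = Suc k\<close>
  the two terms of the numerator cancel. The denominator restores constants.\<close>

fun richardson :: "real \<Rightarrow> nat \<Rightarrow> (real \<Rightarrow> real) \<Rightarrow> real \<Rightarrow> real" where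
  "richardson b 0 f s = f s"
| "richardson b (Suc k) f s =
     (b ^ Suc k * richardson b k f s - richardson b k f (b * s)) / (b ^ Suc k - 1)"

lemma richardson_sum:
  "richardson b k (\<lambda>s. \<Sum>i\<in>I. a i * f i s) s = (\<Sum>i\<in>I. a i * richardson b k (f i) s)"
proof (induction k arbitrary: s)
  case (Suc k)
  show ?case
    by (simp only: richardson.simps Suc sum_distrib_left sum_subtractf [symmetric] sum_divide_distrib)
      (intro sum.cong refl, simp add: field_simps)
qed simp

text \<open>This shows exactness: for \<open>1 \<le> m \<le> k\<close> the factor
  \<open>j = m\<close> vanishes, and for \<open>m = 0\<close> and \<open>b > 1\<close> every factor
  is 1.\<close>

lemma richardson_power:
  "richardson b k (\<lambda>s. s ^ m) s = (\<Prod>j=1..k. (b ^ j - b ^ m) / (b ^ j - 1)) * s ^ m"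
proof (induction k arbitrary: s)
  case (Suc k)
  show ?case
    by (simp only: richardson.simps Suc prod.nat_ivl_Suc' power_mult_distrib)
      (simp add: field_simps diff_divide_distrib)
qed simp

text \<open>Each level multiplies the error bound by \<open>(8 * B + 1) / (8 * B - 1)\<close> with
  \<open>B = 8 ^ k\<close>. The bound \<open>2 - (1/8) ^ k\<close> starts at 1, stays below 2 and
  grows fast enough for the induction to close.\<close>

lemma richardson_near_constant:
  assumes "\<And>i. i \<le> k \<Longrightarrow> \<bar>f (8 ^ i * s) - a\<bar> \<le> e"
  shows "\<bar>richardson 8 k f s - a\<bar> \<le> e * (2 - (1/8) ^ k)"
  using assms
proof (induction k arbitrary: s)
  case 0
  from "0.prems"[of 0] show ?case by simp
next
  case (Suc k)
  define B :: real where "B = 8 ^ k"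
  have B: "B \<ge> 1" by (simp add: B_def)
  have e: "e \<ge> 0" using Suc.prems[of 0] by simp
  define u v where "u = richardson 8 k f s - a" and "v = richardson 8 k f (8 * s) - a"
  have u: "\<bar>u\<bar> \<le> e * (2 - 1 / B)"
    using Suc.IH[of s] Suc.prems by (simp add: u_def B_def power_one_over)
  have "\<bar>f (8 ^ i * (8 * s)) - a\<bar> \<le> e" if "i \<le> k" for i
    using Suc.prems[of "Suc i"] that by (simp add: ac_simps)
  then have v: "\<bar>v\<bar> \<le> e * (2 - 1 / B)"
    using Suc.IH[of "8 * s"] by (simp add: v_def B_def power_one_over)
  have "richardson 8 (Suc k) f s - a = (8 * B * u - v) / (8 * B - 1)"
    using B by (simp add: u_def v_def B_def [symmetric] field_simps)
  then have "\<bar>richardson 8 (Suc k) f s - a\<bar> = \<bar>8 * B * u - v\<bar> / (8 * B - 1)"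
    using B by (simp add: abs_divide)
  also have "\<dots> \<le> (8 * B * (e * (2 - 1 / B)) + e * (2 - 1 / B)) / (8 * B - 1)"
  proof (rule divide_right_mono)
    have "\<bar>8 * B * u - v\<bar> \<le> 8 * B * \<bar>u\<bar> + \<bar>v\<bar>"
      using abs_triangle_ineq4[of "8 * B * u" v] B by (simp add: abs_mult)
    also have "\<dots> \<le> 8 * B * (e * (2 - 1 / B)) + e * (2 - 1 / B)"
      using u v B by (intro add_mono mult_left_mono) auto
    finally show "\<bar>8 * B * u - v\<bar> \<le> 8 * B * (e * (2 - 1 / B)) + e * (2 - 1 / B)" .
  qed (use B in simp)
  also have "\<dots> = e * ((8 * B + 1) * (2 - 1 / B) / (8 * B - 1))"
    by (simp add: algebra_simps diff_divide_distrib add_divide_distrib)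
  also have "\<dots> \<le> e * (2 - 1 / (8 * B))"
  proof (rule mult_left_mono [OF _ e])
    have "(8 * B + 1) * (2 - 1 / B) \<le> (2 - 1 / (8 * B)) * (8 * B - 1)"
    proof -
      have "(8 * B + 1) * (2 - 1 / B) = 16 * B - 6 - 1 / B"
        using B by (simp add: field_simps)
      also have "\<dots> \<le> 16 * B - 3 + 1 / B / 8"
        using B by (simp add: field_simps)
      also have "\<dots> = (2 - 1 / (8 * B)) * (8 * B - 1)"
        using B by (simp add: field_simps)
      finally show ?thesis .
    qed
    then show "(8 * B + 1) * (2 - 1 / B) / (8 * B - 1) \<le> 2 - 1 / (8 * B)"
      using B by (simp add: pos_divide_le_eq)
  qed
  finally show ?case
    by (simp add: B_def power_one_over)
qed

text \<open>Controls the amplification of the surviving degrees \<open>m > k\<close>: each of the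
  \<open>k\<close> factors has numerator at most \<open>b ^ m\<close> in absolute value and
  denominator at least 1.\<close>

lemma richardson_power_bound:
  fixes b :: real
  assumes "b \<ge> 2" and "k < m"
  shows "\<bar>\<Prod>j=1..k. (b ^ j - b ^ m) / (b ^ j - 1)\<bar> \<le> (b ^ k) ^ m"
proof -
  have "\<bar>(b ^ j - b ^ m) / (b ^ j - 1)\<bar> \<le> b ^ m" if "j \<in> {1..k}" for j
  proof -
    have "b ^ j \<ge> b ^ 1"
      using assms that by (intro power_increasing) auto
    then have j: "b ^ j - 1 \<ge> 1" using assms by simp
    have "b ^ j \<le> b ^ m"
      using assms that by (intro power_increasing) auto
    then have "\<bar>(b ^ j - b ^ m) / (b ^ j - 1)\<bar> = (b ^ m - b ^ j) / (b ^ j - 1)"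
      using j by (simp add: abs_divide)
    also have "\<dots> \<le> (b ^ m - b ^ j) / 1"
      using j \<open>b ^ j \<le> b ^ m\<close> by (intro divide_left_mono) auto
    also have "\<dots> \<le> b ^ m" using j by simp
    finally show ?thesis .
  qed
  then have "(\<Prod>j=1..k. \<bar>(b ^ j - b ^ m) / (b ^ j - 1)\<bar>) \<le> (\<Prod>j=1..k. b ^ m)"
    by (intro prod_mono) auto
  then show ?thesis
    by (simp add: abs_prod power_mult [symmetric] mult.commute)
qed

lemma sum_power_tail_le:
  fixes y :: real
  assumes "0 \<le> y" "y \<le> 1/2"
  shows "(\<Sum>m\<in>{k<..n}. y ^ m) \<le> y ^ k"
proof (cases "k \<le> n")
  case True
  \<comment> \<open>The subtracted \<open>y ^ n\<close> carries the induction: since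
    \<open>2 * y ^ Suc n \<le> y ^ n\<close>, it pays for the next term and for its own
    successor.\<close>
  then have "(\<Sum>m\<in>{k<..n}. y ^ m) \<le> y ^ k - y ^ n"
  proof (induction n rule: dec_induct)
    case (step n)
    have "2 * y ^ Suc n \<le> y ^ n"
      using mult_right_mono[of "2 * y" 1 "y ^ n"] assms by simp
    moreover have "{k<..Suc n} = insert (Suc n) {k<..n}" using step by auto
    ultimately show ?case using step by simp
  qed simp
  then show ?thesis using assms by (smt (verit) zero_le_power)
next
  case False
  then show ?thesis using assms by simp
qed

text \<open>In the binomial expansion the constant term 1 is reproduced, degrees 1 to
  \<open>k\<close> are killed, and degree \<open>m > k\<close> contributes at most the
  \<open>m\<close>-th power of \<open>D * s * 8 ^ k\<close>. The rest is a geometric tail.\<close>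

lemma richardson_one_minus_power_error:
  assumes n: "n \<le> D" and s: "s \<ge> 0" and y: "real D * s * 8 ^ k \<le> 1/2"
  shows "\<bar>richardson 8 k (\<lambda>s. (1 - s) ^ n) s - 1\<bar> \<le> (real D * s * 8 ^ k) ^ k"
proof -
  define y where "y = real D * s * 8 ^ k"
  define l where "l m = (\<Prod>j=1..k. ((8::real) ^ j - 8 ^ m) / (8 ^ j - 1))" for m
  define a where "a m = real (n choose m) * (-1) ^ m" for m
  have "(1 - s) ^ n = (\<Sum>m\<le>n. a m * s ^ m)" for s :: real
    using binomial_ring[of "- s" 1 n]
    by (simp add: a_def power_minus[of s] mult.assoc)
  then have "richardson 8 k (\<lambda>s. (1 - s) ^ n) s = (\<Sum>m\<le>n. a m * (l m * s ^ m))"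
    by (simp add: richardson_sum richardson_power l_def)
  also have "\<dots> = (\<Sum>m\<in>insert 0 {k<..n}. a m * (l m * s ^ m))"
  proof (rule sum.mono_neutral_right)
    show "\<forall>m\<in>{..n} - insert 0 {k<..n}. a m * (l m * s ^ m) = 0"
      by (auto simp: l_def not_less)
  qed auto
  also have "\<dots> = 1 + (\<Sum>m\<in>{k<..n}. a m * (l m * s ^ m))"
  proof -
    have "l 0 = 1"
      unfolding l_def
      by (intro prod.neutral ballI divide_self) (auto simp: less_imp_neq [OF one_less_power, symmetric])
    then show ?thesis by (simp add: a_def)
  qed
  finally have "\<bar>richardson 8 k (\<lambda>s. (1 - s) ^ n) s - 1\<bar> \<le> (\<Sum>m\<in>{k<..n}. \<bar>a m * (l m * s ^ m)\<bar>)"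
    by (simp add: sum_abs)
  also have "\<dots> \<le> (\<Sum>m\<in>{k<..n}. y ^ m)"
  proof (rule sum_mono)
    fix m assume m: "m \<in> {k<..n}"
    have "n choose m \<le> n ^ m" using m by (intro binomial_le_pow) auto
    also have "\<dots> \<le> D ^ m" using n by (rule power_mono) simp
    finally have "real (n choose m) \<le> real D ^ m"
      by (metis of_nat_le_iff of_nat_power)
    moreover have "\<bar>l m\<bar> \<le> (8 ^ k) ^ m"
      unfolding l_def using m by (intro richardson_power_bound) auto
    ultimately have "real (n choose m) * (\<bar>l m\<bar> * s ^ m) \<le> real D ^ m * ((8 ^ k) ^ m * s ^ m)"
      using s by (intro mult_mono) auto
    then show "\<bar>a m * (l m * s ^ m)\<bar> \<le> y ^ m"
      using s by (simp add: a_def y_def abs_mult power_mult_distrib power_abs ac_simps)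
  qed
  also have "\<dots> \<le> y ^ k"
    using assms by (intro sum_power_tail_le) (auto simp: y_def)
  finally show ?thesis by (simp add: y_def)
qed

subsection \<open>Averaging over the cube\<close>

text \<open>For \<open>\<bar>t\<bar> \<le> 1\<close> this is the probability of \<open>x\<close>
  under independent random signs of mean \<open>t\<close>.\<close>

definition bias :: "nat \<Rightarrow> real \<Rightarrow> (nat \<Rightarrow> real) \<Rightarrow> real" where
  "bias d t x = (\<Prod>i\<in>{1..d}. (1 + t * x i) / 2)"

lemma bias_nonneg:
  assumes "x \<in> cube d" "\<bar>t\<bar> \<le> 1"
  shows "bias d t x \<ge> 0"
  unfolding bias_def
proof (rule prod_nonneg)
  fix i assume "i \<in> {1..d}"
  then have "x i = -1 \<or> x i = 1" using assms by (auto simp: cube_def PiE_def Pi_def)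
  then show "(1 + t * x i) / 2 \<ge> 0" using assms by auto
qed

lemma finite_cube: "finite (cube d)"
  by (auto simp: cube_def intro!: finite_PiE)

text \<open>By independence the mean of a product is the product of the means. The case
  \<open>S = {}\<close> says that the total mass is 1.\<close>

lemma sum_bias_monomial:
  assumes "S \<subseteq> {1..d}"
  shows "(\<Sum>x\<in>cube d. bias d t x * (\<Prod>i\<in>S. x i)) = t ^ card S"
proof -
  define f where "f i y = (1 + t * y) / 2 * (if i \<in> S then y else 1)" for i :: nat and y :: real
  have "bias d t x * (\<Prod>i\<in>S. x i) = (\<Prod>i\<in>{1..d}. f i (x i))" for x
  proof -
    have "(\<Prod>i\<in>S. x i) = (\<Prod>i\<in>{1..d}. if i \<in> S then x i else 1)"
      using assms by (simp add: prod.If_cases Int_absorb1)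
    then show ?thesis by (simp only: bias_def f_def prod.distrib)
  qed
  then have "(\<Sum>x\<in>cube d. bias d t x * (\<Prod>i\<in>S. x i)) = (\<Sum>x\<in>cube d. \<Prod>i\<in>{1..d}. f i (x i))"
    by simp
  also have "\<dots> = (\<Prod>i\<in>{1..d}. \<Sum>y\<in>{-1, 1}. f i y)"
    unfolding cube_def by (rule prod_sum_PiE [symmetric, OF finite_atLeastAtMost]) auto
  also have "\<dots> = (\<Prod>i\<in>{1..d}. if i \<in> S then t else 1)"
    by (intro prod.cong) (auto simp: f_def field_simps)
  also have "\<dots> = t ^ card S"
    using assms by (simp add: prod.If_cases Int_absorb1)
  finally show ?thesis .
qed

lemma sum_bias_ml_eval:
  "(\<Sum>x\<in>cube d. bias d t x * ml_eval d c x) = (\<Sum>S\<in>Pow {1..d}. c S * t ^ card S)"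
proof -
  have "(\<Sum>x\<in>cube d. bias d t x * ml_eval d c x)
      = (\<Sum>S\<in>Pow {1..d}. \<Sum>x\<in>cube d. c S * (bias d t x * (\<Prod>i\<in>S. x i)))"
    unfolding ml_eval_def sum_distrib_left by (subst sum.swap) (simp add: ac_simps)
  also have "\<dots> = (\<Sum>S\<in>Pow {1..d}. c S * t ^ card S)"
    by (intro sum.cong refl) (simp add: sum_distrib_left [symmetric] sum_bias_monomial)
  finally show ?thesis .
qed

lemma sum_bias_OR: "(\<Sum>x\<in>cube d. bias d t x * OR d x) = -1 + 2 * ((1 + t) / 2) ^ d"
proof -
  \<comment> \<open>The all-false point, the only one where \<open>OR\<close> is not -1; its
    probability is \<open>((1 + t) / 2) ^ d\<close>.\<close>
  define e where "e = (\<lambda>i\<in>{1..d}. 1::real)"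
  have e: "e \<in> cube d" by (simp add: e_def cube_def)
  have OR: "OR d x = -1 + (if x = e then 2 else 0)" if "x \<in> cube d" for x
  proof (cases "x = e")
    case True
    then show ?thesis by (simp add: OR_def e_def)
  next
    case False
    then obtain i where "x i \<noteq> e i" by auto
    then have "i \<in> {1..d} \<and> x i = -1"
      using that by (cases "i \<in> {1..d}") (auto simp: cube_def e_def PiE_def Pi_def extensional_def)
    then show ?thesis using False by (auto simp: OR_def)
  qed
  have "(\<Sum>x\<in>cube d. bias d t x * OR d x)
      = (\<Sum>x\<in>cube d. - bias d t x + (if x = e then 2 * bias d t x else 0))"
    by (intro sum.cong) (auto simp: OR)
  also have "\<dots> = - (\<Sum>x\<in>cube d. bias d t x) + 2 * bias d t e"
    using e finite_cube by (simp only: sum.distrib sum_negf sum.delta if_True)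
  also have "(\<Sum>x\<in>cube d. bias d t x) = 1"
    using sum_bias_monomial[of "{}" d t] by simp
  also have "bias d t e = ((1 + t) / 2) ^ d"
    by (simp add: bias_def e_def)
  finally show ?thesis by simp
qed

lemma averaged_approximation:
  assumes "\<forall>x\<in>cube d. \<bar>ml_eval d c x - OR d x\<bar> \<le> \<epsilon>" and "\<bar>t\<bar> \<le> 1"
  shows "\<bar>(\<Sum>S\<in>Pow {1..d}. c S * t ^ card S) - (-1 + 2 * ((1 + t) / 2) ^ d)\<bar> \<le> \<epsilon>"
proof -
  have "(\<Sum>S\<in>Pow {1..d}. c S * t ^ card S) - (-1 + 2 * ((1 + t) / 2) ^ d)
      = (\<Sum>x\<in>cube d. bias d t x * (ml_eval d c x - OR d x))"
    by (simp only: sum_bias_ml_eval [symmetric] sum_bias_OR [symmetric] right_diff_distrib sum_subtractf)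
  also have "\<bar>\<dots>\<bar> \<le> (\<Sum>x\<in>cube d. \<bar>bias d t x * (ml_eval d c x - OR d x)\<bar>)"
    by (rule sum_abs)
  also have "\<dots> \<le> (\<Sum>x\<in>cube d. bias d t x * \<epsilon>)"
    using assms by (intro sum_mono) (auto simp: abs_mult bias_nonneg intro!: mult_left_mono)
  also have "\<dots> = \<epsilon>"
    using sum_bias_monomial[of "{}" d t] by (simp add: sum_distrib_right [symmetric])
  finally show ?thesis .
qed

text \<open>By Bernoulli \<open>1 + d * x \<le> (1 + x) ^ d\<close>, and
  \<open>(1 - x) ^ d * (1 + x) ^ d \<le> 1\<close>.\<close>

lemma one_minus_power_le:
  fixes x :: real
  assumes "0 \<le> x" "x \<le> 1"
  shows "(1 - x) ^ d \<le> 1 / (1 + real d * x)"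
proof -
  have "(1 - x) ^ d * (1 + real d * x) \<le> (1 - x) ^ d * (1 + x) ^ d"
    using assms Bernoulli_inequality[of x d] by (intro mult_left_mono) auto
  also have "\<dots> = (1 - x\<^sup>2) ^ d"
    by (simp add: power_mult_distrib [symmetric] algebra_simps power2_eq_square)
  also have "\<dots> \<le> 1"
    using assms by (intro power_le_one) (auto simp: power_le_one)
  finally show ?thesis
    using assms by (simp add: pos_le_divide_eq add_pos_nonneg)
qed

subsection \<open>The trade-off\<close>

lemma card_le_ml_degree:
  assumes "S \<subseteq> {1..d}" "c S \<noteq> 0"
  shows "card S \<le> ml_degree d c"
  unfolding ml_degree_def
proof (rule Max_ge)
  have "{card S | S. S \<subseteq> {1..d} \<and> c S \<noteq> 0} \<subseteq> card ` Pow {1..d}" by auto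
  then show "finite {card S | S. S \<subseteq> {1..d} \<and> c S \<noteq> 0}"
    by (rule finite_subset) simp
qed (use assms in auto)

lemma approximate_OR_degree_pos:
  assumes "\<forall>x\<in>cube d. \<bar>ml_eval d c x - OR d x\<bar> \<le> 1/6" and "d \<ge> 1"
  shows "ml_degree d c \<ge> 1"
proof (rule ccontr)
  assume "\<not> ml_degree d c \<ge> 1"
  then have D: "ml_degree d c = 0" by simp
  \<comment> \<open>Splitting on \<open>c S = 0\<close> also covers the zero polynomial, whose
    \<open>ml_degree\<close> is unspecified.\<close>
  have "c S * 1 ^ card S = c S * (-1) ^ card S" if "S \<in> Pow {1..d}" for S
    using card_le_ml_degree[of S d c] that D by (cases "c S = 0") auto
  then have "(\<Sum>S\<in>Pow {1..d}. c S * 1 ^ card S) = (\<Sum>S\<in>Pow {1..d}. c S * (-1) ^ card S)"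
    by (rule sum.cong [OF refl])
  moreover have "(\<Sum>S\<in>Pow {1..d}. c S * 1 ^ card S) \<ge> 5/6"
    using averaged_approximation[OF assms(1), of 1] unfolding abs_le_iff by simp
  moreover have "(\<Sum>S\<in>Pow {1..d}. c S * (-1) ^ card S) \<le> - 5/6"
    using averaged_approximation[OF assms(1), of "-1"] assms(2)
    unfolding abs_le_iff by (simp add: power_0_left)
  ultimately show False by linarith
qed

text \<open>Keeps \<open>log 2 W\<close> away from 0, so that additive constants in the final
  exponent can be absorbed into a multiple of its square root.\<close>

lemma approximate_OR_weight_ge:
  assumes approx: "\<forall>x\<in>cube d. \<bar>ml_eval d c x - OR d x\<bar> \<le> 1/6" and "d \<ge> 2"
  shows "ml_weight d c \<ge> 3/2"
proof -
  define q where "q t = (\<Sum>S\<in>Pow {1..d}. c S * t ^ card S)" for t :: real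
  have "(1/2::real) ^ d \<le> (1/2) ^ 2"
    using \<open>d \<ge> 2\<close> by (intro power_decreasing) auto
  then have "q 0 \<le> - 1/3"
    using averaged_approximation[OF approx, of 0]
    unfolding abs_le_iff by (simp add: q_def power2_eq_square)
  moreover have "q 1 \<ge> 5/6"
    using averaged_approximation[OF approx, of 1] unfolding abs_le_iff by (simp add: q_def)
  \<comment> \<open>Only the coefficient of the empty set occurs in \<open>q 0\<close>, so every
    coefficient enters with factor 1 or -1.\<close>
  moreover have "q 1 - 2 * q 0 \<le> ml_weight d c"
    unfolding q_def ml_weight_def sum_distrib_left sum_subtractf [symmetric]
    by (intro sum_mono) (auto simp: power_0_left)
  ultimately show ?thesis by linarith
qed

lemma approximate_OR_weight_degree:
  assumes approx: "\<forall>x\<in>cube d. \<bar>ml_eval d c x - OR d x\<bar> \<le> 1/6" and d: "d \<ge> 1"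
    and y: "22 * 8 ^ k * real (ml_degree d c) / real d \<le> 1/2"
  shows "ml_weight d c * (22 * 8 ^ k * real (ml_degree d c) / real d) ^ k > 1"
proof -
  define D where "D = ml_degree d c"
  define s where "s = 22 / real d"
  define I where "I = Pow {1..d}"
  define u where "u s = (\<Sum>S\<in>I. c S * (1 - s) ^ card S)" for s :: real
  have s: "s > 0" using d by (simp add: s_def)
  have D: "real D \<ge> 1"
    using approximate_OR_degree_pos[OF approx d] by (simp add: D_def)
  have y': "real D * s * 8 ^ k \<le> 1/2" using y by (simp add: D_def s_def ac_simps)
  have u: "\<bar>u r - (-1 + 2 * (1 - r / 2) ^ d)\<bar> \<le> 1/6" if "0 \<le> r" "r \<le> 2" for r
  proof -
    have half: "(1 + (1 - r)) / 2 = 1 - r / 2" by (simp add: field_simps)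
    show ?thesis
      using averaged_approximation[OF approx, of "1 - r"] that
      unfolding half u_def I_def by linarith
  qed
  have "\<bar>u (8 ^ i * s) - (-1)\<bar> \<le> 1/3" if "i \<le> k" for i
  proof -
    define r where "r = 8 ^ i * s"
    have "r \<ge> 1 * s" unfolding r_def using s by (intro mult_right_mono) auto
    have "r \<le> 8 ^ k * s"
      unfolding r_def using s that by (intro mult_right_mono power_increasing) auto
    \<comment> \<open>Inserting \<open>D \<ge> 1\<close> lets the smallness hypothesis keep every
      node inside the range where \<open>u\<close> is controlled.\<close>
    also have "\<dots> \<le> real D * (8 ^ k * s)"
      using mult_right_mono[OF D, of "8 ^ k * s"] s by simp
    also have "\<dots> \<le> 1/2" using y' by (simp add: ac_simps)
    finally have "r \<le> 1/2" .
    \<comment> \<open>The 22 gives \<open>1 + 22 / 2 = 12\<close>: twice 1/12 plus the approximation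
      error 1/6 is the required 1/3.\<close>
    have "real d * s = 22" using d by (simp add: s_def)
    moreover have "real d * s \<le> real d * r" using \<open>r \<ge> 1 * s\<close> by (intro mult_left_mono) auto
    ultimately have "1 + real d * (r / 2) \<ge> 12" by simp
    then have "1 / (1 + real d * (r / 2)) \<le> 1 / 12"
      by (rule frac_le[rotated 3]) simp_all
    with one_minus_power_le[of "r / 2" d] have "(1 - r / 2) ^ d \<le> 1 / 12"
      using \<open>r \<ge> 1 * s\<close> \<open>r \<le> 1/2\<close> s by linarith
    moreover have "(1 - r / 2) ^ d \<ge> 0" using \<open>r \<le> 1/2\<close> by simp
    ultimately show ?thesis
      using u[of r] \<open>r \<ge> 1 * s\<close> \<open>r \<le> 1/2\<close> s unfolding r_def [symmetric] by linarith
  qed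
  then have "\<bar>richardson 8 k u s - (-1)\<bar> \<le> 1/3 * (2 - (1/8) ^ k)"
    by (rule richardson_near_constant)
  also have "\<dots> \<le> 2/3" by simp
  finally have "richardson 8 k u s + 1 \<le> 2/3" by linarith
  moreover have "u 0 \<ge> 5/6" using u[of 0] unfolding abs_le_iff by simp
  ultimately have "1 < \<bar>richardson 8 k u s - u 0\<bar>" by linarith
  \<comment> \<open>As \<open>u 0\<close> is the sum of all \<open>c S\<close>, linearity splits the
    gap into the extrapolation errors of the single powers.\<close>
  also have "richardson 8 k u s - u 0
      = (\<Sum>S\<in>I. c S * (richardson 8 k (\<lambda>s. (1 - s) ^ card S) s - 1))"
    unfolding u_def [abs_def] richardson_sum
    by (simp add: right_diff_distrib sum_subtractf)
  also have "\<bar>\<dots>\<bar> \<le> (\<Sum>S\<in>I. \<bar>c S * (richardson 8 k (\<lambda>s. (1 - s) ^ card S) s - 1)\<bar>)"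
    by (rule sum_abs)
  also have "\<dots> \<le> (\<Sum>S\<in>I. \<bar>c S\<bar> * (real D * s * 8 ^ k) ^ k)"
  proof (rule sum_mono)
    fix S assume "S \<in> I"
    show "\<bar>c S * (richardson 8 k (\<lambda>s. (1 - s) ^ card S) s - 1)\<bar> \<le> \<bar>c S\<bar> * (real D * s * 8 ^ k) ^ k"
    proof (cases "c S = 0")
      case False
      then have "card S \<le> D"
        using \<open>S \<in> I\<close> card_le_ml_degree[of S d c] by (auto simp: D_def I_def)
      with s y' show ?thesis
        unfolding abs_mult by (intro mult_left_mono richardson_one_minus_power_error) auto
    qed simp
  qed
  also have "\<dots> = ml_weight d c * (22 * 8 ^ k * real (ml_degree d c) / real d) ^ k"
    by (simp add: ml_weight_def I_def D_def s_def sum_distrib_right ac_simps)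
  finally show ?thesis .
qed

lemma approximate_OR_degree_ge:
  assumes approx: "\<forall>x\<in>cube d. \<bar>ml_eval d c x - OR d x\<bar> \<le> 1/6" and "d \<ge> 2"
  shows "real d / 2 powr (22 * sqrt (log 2 (ml_weight d c))) \<le> real (ml_degree d c)"
proof (rule ccontr)
  define W where "W = ml_weight d c"
  define r where "r = sqrt (log 2 W)"
  \<comment> \<open>With \<open>k \<ge> r\<close> the weight is at most
    \<open>2 powr (k\<^sup>2)\<close>, which \<open>y ^ k\<close> cancels once
    \<open>y \<le> 2 powr (- k)\<close>.\<close>
  define k where "k = nat \<lceil>r\<rceil>"
  define y where "y = 22 * 8 ^ k * real (ml_degree d c) / real d"
  assume "\<not> ?thesis"
  then have "real (ml_degree d c) * 2 powr (22 * r) < real d"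
    by (simp add: not_le W_def r_def field_simps)
  then have D: "real (ml_degree d c) / real d \<le> 2 powr (- (22 * r))"
    using \<open>d \<ge> 2\<close> by (simp add: powr_minus field_simps)
  have W: "W \<ge> 3/2" unfolding W_def using assms by (rule approximate_OR_weight_ge)
  have "1 = log 2 2" by simp
  also have "\<dots> \<le> log 2 (W ^ 2)"
    using W power_mono[of "3/2" W 2] by (subst log_le_cancel_iff) (auto simp: power2_eq_square)
  also have "\<dots> = 2 * log 2 W" using W by (simp add: log_nat_power)
  finally have logW: "log 2 W \<ge> 1/2" by simp
  then have "r\<^sup>2 = log 2 W" by (simp add: r_def)
  have r: "r \<ge> 1/2"
    unfolding r_def using logW by (intro real_le_rsqrt) (auto simp: power2_eq_square)
  have k: "r \<le> real k" "real k \<le> r + 1" "k \<ge> 1"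
    using r by (auto simp: k_def) linarith+
  have "y \<le> 2 powr 5 * 2 powr (3 * real k) * 2 powr (- (22 * r))"
  proof -
    have "(8::real) ^ k = 2 powr (3 * real k)"
      by (simp add: powr_powr [symmetric] powr_realpow)
    then have "y = 22 * 2 powr (3 * real k) * (real (ml_degree d c) / real d)"
      by (simp add: y_def)
    also have "\<dots> \<le> 2 powr 5 * 2 powr (3 * real k) * 2 powr (- (22 * r))"
      using D by (intro mult_mono) auto
    finally show ?thesis .
  qed
  also have "\<dots> = 2 powr (5 + 3 * real k - 22 * r)"
    by (simp only: powr_add [symmetric] diff_conv_add_uminus)
  \<comment> \<open>This fixes the exponent constant 22: \<open>5 + 4 * k \<le> 9 + 4 * r\<close>,
    and \<open>9 \<le> 18 * r\<close> because \<open>r \<ge> 1/2\<close>.\<close>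
  also have "\<dots> \<le> 2 powr (- real k)"
    using k r by (intro powr_mono) auto
  finally have y: "y \<le> 2 powr (- real k)" .
  also have "\<dots> \<le> 2 powr (- 1)" using k by (intro powr_mono) auto
  finally have "y \<le> 1/2" by (simp add: powr_minus)
  then have "1 < W * y ^ k"
    unfolding y_def W_def using assms by (intro approximate_OR_weight_degree) auto
  also have "\<dots> \<le> 2 powr (r\<^sup>2) * (2 powr (- real k)) ^ k"
  proof (rule mult_mono)
    show "W \<le> 2 powr (r\<^sup>2)" using W by (simp add: \<open>r\<^sup>2 = log 2 W\<close>)
    show "y ^ k \<le> (2 powr (- real k)) ^ k"
      using y by (intro power_mono) (auto simp: y_def)
  qed (auto simp: y_def)
  also have "(2 powr (- real k)) ^ k = 2 powr (- ((real k)\<^sup>2))"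
    by (simp add: powr_power power2_eq_square)
  also have "2 powr (r\<^sup>2) * 2 powr (- ((real k)\<^sup>2)) = 2 powr (r\<^sup>2 - (real k)\<^sup>2)"
    by (simp add: powr_add [symmetric])
  also have "\<dots> \<le> 2 powr 0"
    using k r power_mono[of r "real k" 2] by (intro powr_mono) auto
  finally show False by simp
qed

(* For W < 1 (possible only when d \<le> 1) log W is negative; max 0 truncates it. *)
theorem theorem5p8:
  "\<exists>C::real. C > 0 \<and>
     (\<forall>(d::nat) (c :: nat set \<Rightarrow> real) (W::real).
        ml_weight d c = W \<longrightarrow>
        (\<forall>x\<in>cube d. \<bar>ml_eval d c x - OR d x\<bar> \<le> 1/6) \<longrightarrow>
        real (ml_degree d c) \<ge> real d / 2 powr (C * sqrt (max 0 (log 2 W))))"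
proof (intro exI[of _ 22] conjI allI impI)
  fix d :: nat and c :: "nat set \<Rightarrow> real" and W :: real
  assume W: "ml_weight d c = W"
    and approx: "\<forall>x\<in>cube d. \<bar>ml_eval d c x - OR d x\<bar> \<le> 1/6"
  consider "d = 0" | "d = 1" | "d \<ge> 2" by linarith
  then show "real (ml_degree d c) \<ge> real d / 2 powr (22 * sqrt (max 0 (log 2 W)))"
  proof cases
    case 1
    then show ?thesis by simp
  next
    case 2
    \<comment> \<open>For \<open>d = 1\<close> the weight may be below 3/2, but a degree of at least
      1 already suffices.\<close>
    have "1 / 2 powr (22 * sqrt (max 0 (log 2 W))) \<le> 1"
      by (simp add: ge_one_powr_ge_zero)
    also have "1 \<le> real (ml_degree d c)"
      using approximate_OR_degree_pos[OF approx] 2 by simp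
    finally show ?thesis using 2 by simp
  next
    case 3
    then have "W \<ge> 3/2" using approximate_OR_weight_ge[OF approx] W by simp
    then have "log 2 W \<ge> 0" by simp
    then show ?thesis using approximate_OR_degree_ge[OF approx 3] W by (simp add: max_def)
  qed
qed simp

end
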